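(* Let $\theta_0\in(1,+\infty]$, $\mathbb X=(1,+\infty)$, $\Theta=(1,\theta_0)$, and consider the one-dimensional Pareto statistical model $$f(x|\theta)=\frac{\theta}{x^2}\,\mathbf 1\{\theta<x\},\qquad x\in\mathbb X,\ \theta\in\Theta.$$ Let $\pi$ be a prior probability distribution with support $\overline\Theta$, admitting a density $q\in L^1(\Theta)$, and let $Q(\theta):=\theta q(\theta)$. Assume that $Q\in W^{1,1}(\Theta)$ and $1/Q\in L^1(\Theta)$, and let $$C_Q(\theta):=Q(\theta)\left(\int_1^\theta Q(\tau)\,d\tau\right)^{-1/2}\left(\int_1^\theta\frac{d\tau}{Q(\tau)}\right)^{1/2}.$$ Then the posterior distribution $$\pi(d\theta|x)=\frac{f(x|\theta)\,q(\theta)}{\int_\Theta f(x|\tau)\,q(\tau)\,d\tau}\,d\theta$$ satisfies $$\mathcal W_2(\pi(\cdot|x_1),\pi(\cdot|x_2))\le K|x_1-x_2|\quad\forall x_1,x_2\in\mathbb X,\qquad\text{where }K:=\sup_{x\in\mathbb X}C_Q(x\wedge\theta_0).$$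
   Context: $\mathcal W_2$ is the 2-Wasserstein distance on probability measures on $\mathbb R$ with finite second moment. $Q\in W^{1,1}(\Theta)$ is identified with its continuous representative (on the closure of $\Theta$). *)

theory Defs
  imports "HOL-Probability.Probability"
begin

definition couplings :: "real measure \<Rightarrow> real measure \<Rightarrow> (real \<times> real) measure set" where
  "couplings \<mu> \<nu> = {\<gamma>. prob_space \<gamma> \<and> sets \<gamma> = sets (borel \<Otimes>\<^sub>M borel)
      \<and> distr \<gamma> borel fst = \<mu> \<and> distr \<gamma> borel snd = \<nu>}"

text \<open>The distance is extended-valued: it is infinite if there is no coupling of finite cost, in
  particular if one of the arguments is not a Borel probability measure. On probability measures
  with finite second moment it is finite.\<close>

definition wasserstein2 :: "real measure \<Rightarrow> real measure \<Rightarrow> ennreal" where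
  "wasserstein2 \<mu> \<nu> =
     (let c = (INF \<gamma>\<in>couplings \<mu> \<nu>. \<integral>\<^sup>+z. ennreal (\<bar>fst z - snd z\<bar>\<^sup>2) \<partial>\<gamma>)
      in if c = \<top> then \<top> else ennreal (sqrt (enn2real c)))"

definition measure_support :: "real measure \<Rightarrow> real set" where
  "measure_support \<mu> = {x. \<forall>U. open U \<and> x \<in> U \<longrightarrow> emeasure \<mu> U > 0}"

definition test_functions :: "real set \<Rightarrow> (real \<Rightarrow> real) set" where
  "test_functions \<Omega> = {\<phi>. (\<forall>n x. (deriv ^^ n) \<phi> field_differentiable (at x))
      \<and> compact (closure {x. \<phi> x \<noteq> 0}) \<and> closure {x. \<phi> x \<noteq> 0} \<subseteq> \<Omega>}"

definition weak_derivative :: "real set \<Rightarrow> (real \<Rightarrow> real) \<Rightarrow> (real \<Rightarrow> real) \<Rightarrow> bool" where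
  "weak_derivative \<Omega> u v \<longleftrightarrow> (\<forall>\<phi>\<in>test_functions \<Omega>.
      (LBINT x:\<Omega>. u x * deriv \<phi> x) = - (LBINT x:\<Omega>. v x * \<phi> x))"

definition sobolev_W11 :: "real set \<Rightarrow> (real \<Rightarrow> real) set" where
  "sobolev_W11 \<Omega> = {u. set_integrable lborel \<Omega> u
      \<and> (\<exists>v. set_integrable lborel \<Omega> v \<and> weak_derivative \<Omega> u v)}"

definition continuous_representative :: "real set \<Rightarrow> (real \<Rightarrow> real) \<Rightarrow> (real \<Rightarrow> real) \<Rightarrow> bool" where
  "continuous_representative \<Omega> u U \<longleftrightarrow>
     continuous_on (closure \<Omega>) U \<and> (AE x in lborel. x \<in> \<Omega> \<longrightarrow> U x = u x)"

definition pareto :: "real \<Rightarrow> real \<Rightarrow> real" where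
  "pareto x \<theta> = \<theta> / x\<^sup>2 * indicator {\<theta>. \<theta> < x} \<theta>"

definition posterior ::
    "real set \<Rightarrow> (real \<Rightarrow> real \<Rightarrow> real) \<Rightarrow> (real \<Rightarrow> real) \<Rightarrow> real \<Rightarrow> real measure" where
  "posterior \<Theta> f q x = density lborel (\<lambda>\<theta>. indicator \<Theta> \<theta> *
     ennreal (f x \<theta> * q \<theta> / (LBINT \<tau>:\<Theta>. f x \<tau> * q \<tau>)))"

definition C_fun :: "(real \<Rightarrow> real) \<Rightarrow> real \<Rightarrow> real" where
  "C_fun Q \<theta> = Q \<theta> * (LBINT \<tau>:{1<..<\<theta>}. Q \<tau>) powr (-1/2)
     * (LBINT \<tau>:{1<..<\<theta>}. 1 / Q \<tau>) powr (1/2)"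

end

theory Submission
  imports Defs
begin

text \<open>
  Since \<open>f(x|\<theta>) q(\<theta>) = Q(\<theta>) 1{\<theta> < x} / x\<^sup>2\<close>, the posterior at \<open>x\<close> is the measure \<open>Q d\<theta>\<close> truncated to
  \<open>(1, y)\<close> with \<open>y = min x \<theta>\<^sub>0\<close> and normalised (\<open>posterior_pareto\<close>). The case \<open>\<theta>\<^sub>0 = \<infinity>\<close> is void:
  \<open>Q\<close> and \<open>1 / Q\<close> cannot both be integrable over a set of infinite length, as \<open>Q + 1 / Q \<ge> 1\<close>. So \<open>\<theta>\<^sub>0 = b\<close>
  is a real number and \<open>Q\<close> is continuous on \<open>[1, b]\<close>.

  On the line, truncations are compared along their quantile functions. With \<open>F(t) = \<integral>\<^sub>1\<^sup>t Q\<close>, the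
  quantile function of the truncation at \<open>y\<close> is \<open>G(y, u) = F\<inverse>(u F(y))\<close>, and running \<open>u\<close> through the
  uniform law on \<open>[0, 1]\<close> couples all truncations at once (\<open>distr_quantile\<close>). Moving the truncation point \<open>x\<close>
  moves \<open>G(x, u)\<close> with velocity \<open>u Q(x) / Q(G(x, u))\<close>. The substitution \<open>u = F(t) / F(x)\<close> turns
  the mean square of this velocity into
  \[ Q(x)^2 / F(x)^3 \int_1^x F(t)^2 / Q(t) dt \le Q(x)^2 / F(x) \int_1^x dt / Q(t) = C_Q(x)^2, \]
  because \<open>F(t) \<le> F(x)\<close> (\<open>quantile_velocity_energy\<close>, \<open>energy_eq_C_fun_squared\<close>). Hence \<open>y \<mapsto> G(y, \<cdot>)\<close> is a curve in
  \<open>L\<^sup>2(0, 1)\<close> of speed at most \<open>K\<close>, which the Cauchy-Schwarz inequality and Fubini's theorem turn into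
  the distance bound (\<open>quantile_displacement\<close>). Finally \<open>x \<mapsto> min x b\<close> is 1-Lipschitz.

  The delicate point is that \<open>Q\<close> may vanish on a null set, so that \<open>F\<inverse>\<close> is not differentiable
  everywhere. The velocity is therefore never obtained by differentiating \<open>F\<inverse>\<close>: its integral is identified with the
  displacement by changing variables along \<open>F\<close>, which is continuously differentiable
  (\<open>quantile_diff\<close>). All these integrals are taken in \<open>[0, \<infinity>]\<close>, where substitution and Fubini's
  theorem ask for measurability only.
\<close>

section \<open>Couplings and integrals\<close>

text \<open>The joint law of two random variables on a common space is one admissible coupling.\<close>

lemma wasserstein2_le_of_coupled_variables:
  fixes c :: ennreal
  assumes "prob_space M" and X[measurable]: "X \<in> borel_measurable M" and Y[measurable]: "Y \<in> borel_measurable M"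
    and le: "(\<integral>\<^sup>+\<omega>. ennreal ((X \<omega> - Y \<omega>)\<^sup>2) \<partial>M) \<le> c\<^sup>2"
  shows "wasserstein2 (distr M borel X) (distr M borel Y) \<le> c"
proof (cases "c = \<top>")
  case False
  then obtain r where c: "c = ennreal r" and r: "0 \<le> r"
    by (cases c) auto
  interpret prob_space M by fact
  let ?\<gamma> = "distr M (borel \<Otimes>\<^sub>M borel) (\<lambda>\<omega>. (X \<omega>, Y \<omega>))"
  let ?I = "INF \<gamma>\<in>couplings (distr M borel X) (distr M borel Y).
      \<integral>\<^sup>+z. ennreal (\<bar>fst z - snd z\<bar>\<^sup>2) \<partial>\<gamma>"
  have "?\<gamma> \<in> couplings (distr M borel X) (distr M borel Y)"
    by (auto simp: couplings_def distr_distr comp_def intro!: prob_space_distr)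
  then have "?I \<le> (\<integral>\<^sup>+z. ennreal (\<bar>fst z - snd z\<bar>\<^sup>2) \<partial>?\<gamma>)"
    by (rule INF_lower)
  also have "\<dots> = (\<integral>\<^sup>+\<omega>. ennreal ((X \<omega> - Y \<omega>)\<^sup>2) \<partial>M)"
    by (subst nn_integral_distr) auto
  finally have I: "?I \<le> ennreal (r\<^sup>2)"
    using le r by (simp add: c ennreal_power)
  then have "?I \<noteq> \<top>"
    by (metis ennreal_less_top leD)
  moreover have "sqrt (enn2real ?I) \<le> r"
    using enn2real_mono[OF I] r by (intro real_le_lsqrt) auto
  ultimately show ?thesis
    unfolding wasserstein2_def Let_def c by (simp only: if_False ennreal_leI)
qed auto

lemma Cauchy_Schwarz_nn_integral_interval:
  fixes f :: "real \<Rightarrow> real"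
  assumes [measurable]: "f \<in> borel_measurable borel" and "p \<le> q" and nonneg: "\<And>x. x \<in> {p..q} \<Longrightarrow> 0 \<le> f x"
  shows "(\<integral>\<^sup>+x. ennreal (f x * indicator {p..q} x) \<partial>lborel)\<^sup>2
    \<le> ennreal (q - p) * (\<integral>\<^sup>+x. ennreal ((f x)\<^sup>2 * indicator {p..q} x) \<partial>lborel)"
proof -
  have 1: "(\<integral>\<^sup>+x. ennreal (f x * indicator {p..q} x) * indicator {p..q} x \<partial>lborel)
    = (\<integral>\<^sup>+x. ennreal (f x * indicator {p..q} x) \<partial>lborel)"
    by (intro nn_integral_cong) (auto simp: indicator_def)
  have 2: "(\<integral>\<^sup>+x. (ennreal (f x * indicator {p..q} x))\<^sup>2 \<partial>lborel)
    = (\<integral>\<^sup>+x. ennreal ((f x)\<^sup>2 * indicator {p..q} x) \<partial>lborel)"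
    by (intro nn_integral_cong) (auto simp: indicator_def ennreal_power nonneg)
  have 3: "(\<integral>\<^sup>+x. (indicator {p..q} x)\<^sup>2 \<partial>lborel) = ennreal (q - p)"
    using \<open>p \<le> q\<close> by (subst nn_integral_cong[where v = "indicator {p..q}"]) (auto simp: indicator_def)
  show ?thesis
    using Cauchy_Schwarz_nn_integral[of "\<lambda>x. ennreal (f x * indicator {p..q} x)" lborel "indicator {p..q}"]
    unfolding 1 2 3 by (simp add: mult.commute)
qed

text \<open>Since \<open>u + 1 / u \<ge> 1\<close> for positive \<open>u\<close>, the constant \<open>1\<close> is integrable over \<open>A\<close>. With \<open>u = Q\<close>
  this is what forces the parameter range to be bounded.\<close>

lemma emeasure_finite_if_integrable_reciprocal:
  fixes u v :: "'a \<Rightarrow> real"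
  assumes A: "A \<in> sets M"
    and u: "set_integrable M A u" and v: "set_integrable M A v"
    and reciprocal: "AE x in M. x \<in> A \<longrightarrow> 0 < u x \<and> v x = 1 / u x"
  shows "emeasure M A < \<infinity>"
proof -
  have "integrable M (indicator A :: 'a \<Rightarrow> real)"
  proof (rule Bochner_Integration.integrable_bound)
    show "integrable M (\<lambda>x. indicator A x *\<^sub>R u x + indicator A x *\<^sub>R v x)"
      using u v unfolding set_integrable_def by (rule Bochner_Integration.integrable_add)
    show "AE x in M. norm (indicator A x :: real) \<le> norm (indicator A x *\<^sub>R u x + indicator A x *\<^sub>R v x)"
      using reciprocal
    proof eventually_elim
      case (elim x)
      have "1 \<le> r + 1 / r" if "0 < r" for r :: real
        using that by (cases "1 \<le> r") (auto simp: add_increasing add_increasing2)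
      with elim show ?case
        by (cases "x \<in> A") force+
    qed
  qed (use A in measurable)
  then show ?thesis
    using A by (simp add: integrable_indicator_iff)
qed

lemma continuous_nonneg_on_closure:
  fixes U :: "real \<Rightarrow> real"
  assumes U: "continuous_on UNIV U" and \<Omega>: "open \<Omega>"
    and ae: "AE x in lborel. x \<in> \<Omega> \<longrightarrow> 0 \<le> U x" and x: "x \<in> closure \<Omega>"
  shows "0 \<le> U x"
proof -
  have C: "closed {x. 0 \<le> U x}"
    using U by (intro closed_Collect_le) auto
  have "\<Omega> \<subseteq> {x. 0 \<le> U x}"
    using mem_closed_if_AE_lebesgue_open[OF \<Omega> C] AE_completion[OF ae] by auto
  then show ?thesis
    using closure_minimal[OF _ C] x by auto
qed

lemma AE_not_endpoint: "AE t in lborel. t \<noteq> p \<and> t \<noteq> q" for p q :: real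
  using AE_lborel_singleton[of p] AE_lborel_singleton[of q] by eventually_elim auto

definition uniform01 :: "real measure" where
  "uniform01 = density lborel (\<lambda>u. ennreal (indicator {0..1} u))"

lemma prob_space_uniform01: "prob_space uniform01"
  unfolding uniform01_def by (rule prob_spaceI) (simp add: emeasure_density ennreal_indicator)

lemma sets_uniform01 [measurable_cong, simp]: "sets uniform01 = sets borel"
  by (simp add: uniform01_def)

section \<open>Quantile functions of truncations\<close>

text \<open>The function \<open>F\<close> is the primitive \<open>t \<mapsto> \<integral>\<^sub>a\<^sup>t Q\<close>. Its derivative \<open>Q\<close> may have zeros in \<open>[a, b]\<close>, but only on a
  null set, so that \<open>F\<close> remains strictly increasing there. The derivatives are two-sided also at the
  end points, as the substitution rule for integrals requires; this is why \<open>Q\<close> is a function on the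
  whole line.\<close>

locale primitive_of_ae_positive =
  fixes a b :: real and Q F :: "real \<Rightarrow> real"
  assumes a_less_b: "a < b"
    and cont: "continuous_on UNIV Q"
    and nonneg: "\<And>t. 0 \<le> Q t"
    and ae_nonzero: "AE t in lborel. t \<in> {a..b} \<longrightarrow> Q t \<noteq> 0"
    and deriv: "\<And>t. t \<in> {a..b} \<Longrightarrow> (F has_real_derivative Q t) (at t)"
    and F_a: "F a = 0"
begin

lemma Q_measurable [measurable]: "Q \<in> borel_measurable borel"
  by (rule borel_measurable_continuous_onI[OF cont])

lemma nn_integral_Q:
  assumes "a \<le> p" "p \<le> q" "q \<le> b"
  shows "(\<integral>\<^sup>+t. ennreal (Q t) * indicator {p..q} t \<partial>lborel) = ennreal (F q - F p)"
  using assms by (intro nn_integral_FTC_Icc nonneg deriv) auto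

lemma integral_Q:
  assumes "a \<le> y" "y \<le> b"
  shows "(\<integral>t. Q t * indicator {a..y} t \<partial>lborel) = F y"
  using assms by (subst integral_FTC_Icc_nonneg[where F = F]) (auto intro: deriv nonneg simp: F_a)

lemma F_strict_mono:
  assumes "a \<le> p" "p < q" "q \<le> b"
  shows "F p < F q"
proof (rule ccontr)
  assume "\<not> F p < F q"
  with assms nn_integral_Q[of p q] have "(\<integral>\<^sup>+t. ennreal (Q t) * indicator {p..q} t \<partial>lborel) = 0"
    by (simp add: ennreal_neg)
  then have "AE t in lborel. ennreal (Q t) * indicator {p..q} t = 0"
    by (subst (asm) nn_integral_0_iff_AE) auto
  with ae_nonzero have "AE t in lborel. t \<notin> {p..q}"
  proof eventually_elim
    case (elim t)
    with assms nonneg[of t] show ?case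
      by (auto simp: indicator_def split: if_splits)
  qed
  then have "emeasure lborel {p..q} = 0"
    by (subst (asm) AE_iff_measurable[where N = "{p..q}"]) auto
  with assms show False by simp
qed

lemma F_mono: "a \<le> p \<Longrightarrow> p \<le> q \<Longrightarrow> q \<le> b \<Longrightarrow> F p \<le> F q"
  using F_strict_mono[of p q] by (cases "p = q") auto

lemma F_nonneg: "t \<in> {a..b} \<Longrightarrow> 0 \<le> F t"
  using F_mono[of a t] F_a by auto

lemma F_pos: "a < t \<Longrightarrow> t \<le> b \<Longrightarrow> 0 < F t"
  using F_strict_mono[of a t] F_a by auto

lemma F_continuous: "continuous_on {a..b} F"
  using deriv by (meson DERIV_isCont continuous_at_imp_continuous_on)

text \<open>The inverse of \<open>F\<close> on \<open>[0, F b]\<close>. Written as a supremum it is monotone, hence Borel measurable, on the whole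
  line; the maximum with \<open>0 = F a\<close> keeps the set nonempty.\<close>

definition Finv :: "real \<Rightarrow> real" where
  "Finv s = Sup {t \<in> {a..b}. F t \<le> max 0 s}"

lemma Finv_mono: "mono Finv"
proof
  fix s s' :: real assume "s \<le> s'"
  then show "Finv s \<le> Finv s'"
    unfolding Finv_def using a_less_b F_a by (intro cSup_subset_mono) (auto intro!: exI[of _ a] bdd_aboveI[of _ b])
qed

lemma Finv_measurable [measurable]: "Finv \<in> borel_measurable borel"
  by (rule borel_measurable_mono[OF Finv_mono])

lemma Finv_F [simp]:
  assumes "t \<in> {a..b}" shows "Finv (F t) = t"
  unfolding Finv_def
proof (rule cSup_eq_maximum)
  show "t \<in> {t' \<in> {a..b}. F t' \<le> max 0 (F t)}"
    using assms by auto
next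
  fix x assume "x \<in> {t' \<in> {a..b}. F t' \<le> max 0 (F t)}"
  then show "x \<le> t"
    using assms F_nonneg[OF assms] F_strict_mono[of t x] by force
qed

lemma F_attains:
  assumes "u \<in> {0..1}" "y \<in> {a..b}"
  obtains t where "t \<in> {a..y}" "F t = u * F y"
proof -
  have "\<exists>t\<ge>a. t \<le> y \<and> F t = u * F y"
    using assms F_nonneg[OF assms(2)] F_a
    by (intro IVT') (auto intro: mult_left_le_one_le continuous_on_subset[OF F_continuous])
  then show ?thesis using that by auto
qed

lemma Finv_range:
  assumes "u \<in> {0..1}" "y \<in> {a..b}"
  shows "Finv (u * F y) \<in> {a..y}"
  by (rule F_attains[OF assms]) (use assms in \<open>metis Finv_F atLeastAtMost_iff order_trans\<close>)

lemma F_Finv: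
  assumes "u \<in> {0..1}" "y \<in> {a..b}"
  shows "F (Finv (u * F y)) = u * F y"
  by (rule F_attains[OF assms]) (use assms in \<open>metis Finv_F atLeastAtMost_iff order_trans\<close>)

text \<open>The change of variables \<open>s = c F(t)\<close>. It has three uses: for \<open>c = 1\<close> and \<open>c = u\<close> it relates the displacement of a quantile
  to its velocity, and for \<open>c = 1 / F y\<close> it parametrises the level \<open>u\<close> by the quantile \<open>t\<close> of
  the truncation at \<open>y\<close>.\<close>

lemma substitution_F:
  assumes [measurable]: "h \<in> borel_measurable borel" and "0 \<le> c" "a \<le> p" "p \<le> q" "q \<le> b"
  shows "(\<integral>\<^sup>+s. ennreal (h s * indicator {c * F p..c * F q} s) \<partial>lborel)
    = (\<integral>\<^sup>+t. ennreal (h (c * F t) * (c * Q t) * indicator {p..q} t) \<partial>lborel)"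
proof (rule nn_integral_substitution)
  show "((\<lambda>t. c * F t) has_real_derivative c * Q t) (at t)" if "t \<in> {p..q}" for t
    using that assms by (intro DERIV_cmult deriv) auto
  show "set_borel_measurable borel {c * F p..c * F q} h"
    unfolding set_borel_measurable_def by measurable
qed (use assms nonneg in \<open>auto intro!: continuous_intros continuous_on_subset[OF cont]\<close>)

text \<open>The quantile at level \<open>u\<close> of the measure \<open>Q dt\<close> truncated to \<open>[a, y]\<close> and normalised.\<close>

definition quantile :: "real \<Rightarrow> real \<Rightarrow> real" where
  "quantile y u = Finv (u * F y)"

text \<open>The formal derivative of \<open>quantile x u\<close> with respect to the truncation point \<open>x\<close>.\<close>

definition quantile_velocity :: "real \<Rightarrow> real \<Rightarrow> real" where
  "quantile_velocity u x = u * Q x / Q (Finv (u * F x))"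

lemma quantile_measurable [measurable]: "quantile y \<in> borel_measurable borel"
  unfolding quantile_def[abs_def] by measurable

text \<open>The length of the interval between the two quantiles is \<open>\<integral> Q / Q\<close> over that interval, because \<open>Q\<close> is nonzero almost
  everywhere. The substitution \<open>s = F(t)\<close> turns this into \<open>\<integral> ds / Q(F\<inverse>(s))\<close> from
  \<open>u F(y)\<close> to \<open>u F(z)\<close>, and the substitution \<open>s = u F(x)\<close> turns that into the integral of the velocity.\<close>

lemma quantile_diff:
  assumes "u \<in> {0..1}" "a \<le> y" "y \<le> z" "z \<le> b"
  shows "ennreal (quantile z u - quantile y u)
    = (\<integral>\<^sup>+x. ennreal (quantile_velocity u x * indicator {y..z} x) \<partial>lborel)"
proof -
  let ?h = "\<lambda>s. 1 / Q (Finv s)"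
  let ?p = "quantile y u" and ?q = "quantile z u"
  have p: "a \<le> ?p" "?p \<le> b" "F ?p = u * F y" and q: "a \<le> ?q" "?q \<le> b" "F ?q = u * F z"
    using Finv_range[of u y] F_Finv[of u y] Finv_range[of u z] F_Finv[of u z] assms
    by (auto simp: quantile_def)
  have "?p \<le> ?q"
    unfolding quantile_def using assms F_mono[of y z] by (intro monoD[OF Finv_mono] mult_left_mono) auto
  have "ennreal (?q - ?p) = (\<integral>\<^sup>+t. indicator {?p..?q} t \<partial>lborel)"
    using \<open>?p \<le> ?q\<close> by simp
  also have "\<dots> = (\<integral>\<^sup>+t. ennreal (?h (1 * F t) * (1 * Q t) * indicator {?p..?q} t) \<partial>lborel)"
    using ae_nonzero by (intro nn_integral_cong_AE, eventually_elim) (use p q in \<open>auto simp: indicator_def\<close>)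
  also have "\<dots> = (\<integral>\<^sup>+s. ennreal (?h s * indicator {1 * F ?p..1 * F ?q} s) \<partial>lborel)"
    by (rule substitution_F[symmetric]) (use p q \<open>?p \<le> ?q\<close> in auto)
  also have "\<dots> = (\<integral>\<^sup>+s. ennreal (?h s * indicator {u * F y..u * F z} s) \<partial>lborel)"
    by (simp add: p q)
  also have "\<dots> = (\<integral>\<^sup>+x. ennreal (?h (u * F x) * (u * Q x) * indicator {y..z} x) \<partial>lborel)"
    by (rule substitution_F) (use assms in auto)
  finally show ?thesis
    by (simp add: quantile_velocity_def)
qed

text \<open>After the substitution \<open>u = F(t) / F(x)\<close> the integrand is \<open>(F(t) / F(x))\<^sup>2 \<cdot> Q(x)\<^sup>2 / F(x) \<cdot> 1 / Q(t)\<close> wherever \<open>Q(t) \<noteq> 0\<close>,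
  and its first factor is at most 1.\<close>

lemma quantile_velocity_energy:
  assumes "a < x" "x \<le> b"
  shows "(\<integral>\<^sup>+u. ennreal ((quantile_velocity u x)\<^sup>2 * indicator {0..1} u) \<partial>lborel)
    \<le> ennreal ((Q x)\<^sup>2 / F x) * (\<integral>\<^sup>+t. ennreal (1 / Q t * indicator {a..x} t) \<partial>lborel)"
proof -
  have Fx: "0 < F x" by (rule F_pos[OF assms])
  have [measurable]: "(\<lambda>u. (quantile_velocity u x)\<^sup>2) \<in> borel_measurable borel"
    unfolding quantile_velocity_def by measurable
  have "(\<integral>\<^sup>+u. ennreal ((quantile_velocity u x)\<^sup>2 * indicator {0..1} u) \<partial>lborel)
    = (\<integral>\<^sup>+u. ennreal ((quantile_velocity u x)\<^sup>2 * indicator {1 / F x * F a..1 / F x * F x} u) \<partial>lborel)"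
    using Fx by (simp add: F_a)
  also have "\<dots> = (\<integral>\<^sup>+t. ennreal ((quantile_velocity (1 / F x * F t) x)\<^sup>2 * (1 / F x * Q t) * indicator {a..x} t) \<partial>lborel)"
    by (rule substitution_F) (use assms Fx in auto)
  also have "\<dots> \<le> (\<integral>\<^sup>+t. ennreal ((Q x)\<^sup>2 / F x) * ennreal (1 / Q t * indicator {a..x} t) \<partial>lborel)"
  proof (rule nn_integral_mono)
    fix t
    show "ennreal ((quantile_velocity (1 / F x * F t) x)\<^sup>2 * (1 / F x * Q t) * indicator {a..x} t)
      \<le> ennreal ((Q x)\<^sup>2 / F x) * ennreal (1 / Q t * indicator {a..x} t)"
    proof (cases "t \<in> {a..x} \<and> Q t \<noteq> 0")
      case True
      then have t: "t \<in> {a..b}" "0 < Q t" using assms nonneg[of t] by auto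
      have r: "0 \<le> F t / F x" "F t / F x \<le> 1"
        using True t assms Fx F_nonneg[of t] F_mono[of t x] by auto
      then have "(F t / F x)\<^sup>2 \<le> 1"
        by (simp add: power_le_one)
      then have "(F t / F x)\<^sup>2 * ((Q x)\<^sup>2 / F x * (1 / Q t)) \<le> 1 * ((Q x)\<^sup>2 / F x * (1 / Q t))"
        using t Fx by (intro mult_right_mono) auto
      moreover have "(quantile_velocity (1 / F x * F t) x)\<^sup>2 * (1 / F x * Q t)
          = (F t / F x)\<^sup>2 * ((Q x)\<^sup>2 / F x * (1 / Q t))"
        using t Fx by (simp add: quantile_velocity_def field_simps power2_eq_square)
      ultimately show ?thesis
        using True t Fx by (simp add: ennreal_mult[symmetric] ennreal_leI)
    qed (auto simp: indicator_def)
  qed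
  also have "\<dots> = ennreal ((Q x)\<^sup>2 / F x) * (\<integral>\<^sup>+t. ennreal (1 / Q t * indicator {a..x} t) \<partial>lborel)"
    by (intro nn_integral_cmult) measurable
  finally show ?thesis .
qed

text \<open>The substitution \<open>u = F(t) / F(y)\<close> sends the quantile at level \<open>u\<close> to \<open>t\<close> and \<open>du\<close> to \<open>Q(t) / F(y) dt\<close>.\<close>

lemma distr_quantile:
  assumes "a < y" "y \<le> b"
  shows "distr uniform01 borel (quantile y) = density lborel (\<lambda>t. ennreal (Q t / F y * indicator {a..y} t))"
    (is "_ = density lborel ?d")
proof (rule measure_eqI)
  fix A assume "A \<in> sets (distr uniform01 borel (quantile y))"
  then have A[measurable]: "A \<in> sets borel" by simp
  have Fy: "0 < F y" by (rule F_pos[OF assms])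
  have "emeasure (distr uniform01 borel (quantile y)) A
     = (\<integral>\<^sup>+u. indicator A (quantile y u) \<partial>uniform01)"
    by (subst nn_integral_indicator[symmetric], simp, subst nn_integral_distr) auto
  also have "\<dots> = (\<integral>\<^sup>+u. ennreal (indicator {0..1} u) * indicator A (quantile y u) \<partial>lborel)"
    unfolding uniform01_def by (rule nn_integral_density) measurable
  also have "\<dots> = (\<integral>\<^sup>+u. ennreal (indicator A (quantile y u) * indicator {1 / F y * F a..1 / F y * F y} u) \<partial>lborel)"
    using Fy by (intro nn_integral_cong) (auto simp: F_a indicator_def)
  also have "\<dots> = (\<integral>\<^sup>+t. ennreal (indicator A (quantile y (1 / F y * F t)) * (1 / F y * Q t) * indicator {a..y} t) \<partial>lborel)"
    by (rule substitution_F) (use assms Fy in auto)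
  also have "\<dots> = (\<integral>\<^sup>+t. ?d t * indicator A t \<partial>lborel)"
    using Fy assms by (intro nn_integral_cong) (auto simp: indicator_def quantile_def)
  also have "\<dots> = emeasure (density lborel ?d) A"
    by (rule emeasure_density[symmetric]) measurable
  finally show "emeasure (distr uniform01 borel (quantile y)) A = emeasure (density lborel ?d) A" .
qed simp

text \<open>Fubini's theorem needs the velocity to be jointly measurable, but \<open>F\<close> is continuous only on \<open>[a, b]\<close>
  and arbitrary elsewhere. The cut-off makes it Borel measurable.\<close>

lemma F_measurable_on [measurable]: "(\<lambda>x. F x * indicator {a..b} x) \<in> borel_measurable borel"
  using borel_measurable_continuous_on_indicator[OF _ F_continuous] by (simp add: mult.commute)

text \<open>By the Cauchy-Schwarz inequality in \<open>x\<close>, the squared displacement at level \<open>u\<close> is at most \<open>z - y\<close> times the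
  integral over \<open>[y, z]\<close> of the squared velocity. Exchanging the integrals, the mean over \<open>u\<close> at
  fixed \<open>x\<close> is at most \<open>K\<^sup>2\<close>, which yields the second factor \<open>z - y\<close>.\<close>

lemma quantile_displacement:
  fixes K :: ennreal
  assumes yz: "a < y" "y \<le> z" "z \<le> b"
    and K: "\<And>x. x \<in> {y..z} \<Longrightarrow>
      ennreal ((Q x)\<^sup>2 / F x) * (\<integral>\<^sup>+t. ennreal (1 / Q t * indicator {a..x} t) \<partial>lborel) \<le> K\<^sup>2"
  shows "(\<integral>\<^sup>+u. ennreal ((quantile z u - quantile y u)\<^sup>2) \<partial>uniform01) \<le> (K * ennreal (z - y))\<^sup>2"
proof -
  \<comment> \<open>The velocity cut off to \<open>[y, z]\<close>, in a form that is measurable on the whole plane.\<close>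
  define w where "w u x = (u * Q x / Q (Finv (u * (F x * indicator {a..b} x)))) * indicator {y..z} x" for u x
  have w: "quantile_velocity u x * indicator {y..z} x = w u x" for u x
    using yz by (auto simp: w_def quantile_velocity_def indicator_def)
  have [measurable]: "(\<lambda>(u, x). w u x) \<in> borel_measurable (borel \<Otimes>\<^sub>M borel)"
    unfolding w_def by measurable
  have [measurable]: "w u \<in> borel_measurable borel" for u
    unfolding w_def by measurable
  have w2: "(w u x)\<^sup>2 = (quantile_velocity u x)\<^sup>2 * indicator {y..z} x" for u x
    unfolding w[symmetric] by (auto simp: indicator_def)
  have pointwise: "ennreal ((quantile z u - quantile y u)\<^sup>2)
      \<le> ennreal (z - y) * (\<integral>\<^sup>+x. ennreal ((w u x)\<^sup>2) \<partial>lborel)" if u: "u \<in> {0..1}" for u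
  proof -
    have "quantile y u \<le> quantile z u"
      unfolding quantile_def using u yz F_mono[of y z] by (intro monoD[OF Finv_mono] mult_left_mono) auto
    then have "ennreal ((quantile z u - quantile y u)\<^sup>2) = (ennreal (quantile z u - quantile y u))\<^sup>2"
      by (simp add: ennreal_power)
    also have "\<dots> = (\<integral>\<^sup>+x. ennreal (w u x) \<partial>lborel)\<^sup>2"
      using quantile_diff[OF u, of y z] yz by (simp add: w)
    also have "\<dots> = (\<integral>\<^sup>+x. ennreal (w u x * indicator {y..z} x) \<partial>lborel)\<^sup>2"
      by (intro arg_cong[where f = "\<lambda>v. v\<^sup>2"] nn_integral_cong) (simp add: w_def indicator_def)
    also have "\<dots> \<le> ennreal (z - y) * (\<integral>\<^sup>+x. ennreal ((w u x)\<^sup>2 * indicator {y..z} x) \<partial>lborel)"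
      using u yz nonneg by (intro Cauchy_Schwarz_nn_integral_interval) (auto simp: w_def)
    also have "(\<integral>\<^sup>+x. ennreal ((w u x)\<^sup>2 * indicator {y..z} x) \<partial>lborel) = (\<integral>\<^sup>+x. ennreal ((w u x)\<^sup>2) \<partial>lborel)"
      by (intro nn_integral_cong) (simp add: w_def indicator_def)
    finally show ?thesis .
  qed
  have energy: "(\<integral>\<^sup>+u. (\<integral>\<^sup>+x. ennreal ((w u x)\<^sup>2 * indicator {0..1} u) \<partial>lborel) \<partial>lborel)
      \<le> K\<^sup>2 * ennreal (z - y)"
  proof -
    have "(\<integral>\<^sup>+u. (\<integral>\<^sup>+x. ennreal ((w u x)\<^sup>2 * indicator {0..1} u) \<partial>lborel) \<partial>lborel)
        = (\<integral>\<^sup>+x. (\<integral>\<^sup>+u. ennreal ((w u x)\<^sup>2 * indicator {0..1} u) \<partial>lborel) \<partial>lborel)"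
      by (rule lborel_pair.Fubini'[symmetric]) measurable
    also have "\<dots> \<le> (\<integral>\<^sup>+x. K\<^sup>2 * indicator {y..z} x \<partial>lborel)"
    proof (rule nn_integral_mono)
      fix x
      show "(\<integral>\<^sup>+u. ennreal ((w u x)\<^sup>2 * indicator {0..1} u) \<partial>lborel) \<le> K\<^sup>2 * indicator {y..z} x"
        using order_trans[OF quantile_velocity_energy[of x] K[of x]] yz
        by (cases "x \<in> {y..z}") (auto simp: w2)
    qed
    also have "\<dots> = K\<^sup>2 * ennreal (z - y)"
      using yz by (simp add: nn_integral_cmult_indicator)
    finally show ?thesis .
  qed
  have "(\<integral>\<^sup>+u. ennreal ((quantile z u - quantile y u)\<^sup>2) \<partial>uniform01)
      = (\<integral>\<^sup>+u. ennreal (indicator {0..1} u) * ennreal ((quantile z u - quantile y u)\<^sup>2) \<partial>lborel)"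
    unfolding uniform01_def by (rule nn_integral_density) measurable
  also have "\<dots> \<le> (\<integral>\<^sup>+u. ennreal (z - y) * (\<integral>\<^sup>+x. ennreal ((w u x)\<^sup>2 * indicator {0..1} u) \<partial>lborel) \<partial>lborel)"
    using pointwise by (intro nn_integral_mono) (auto simp: indicator_def)
  also have "\<dots> = ennreal (z - y) * (\<integral>\<^sup>+u. (\<integral>\<^sup>+x. ennreal ((w u x)\<^sup>2 * indicator {0..1} u) \<partial>lborel) \<partial>lborel)"
    by (rule nn_integral_cmult) measurable
  also have "\<dots> \<le> ennreal (z - y) * (K\<^sup>2 * ennreal (z - y))"
    by (rule mult_left_mono[OF energy]) simp
  also have "\<dots> = (K * ennreal (z - y))\<^sup>2"
    by (simp add: power2_eq_square mult_ac)
  finally show ?thesis .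
qed

theorem wasserstein2_truncations_le:
  fixes K :: ennreal
  assumes y: "a < y" "y \<le> b" and z: "a < z" "z \<le> b"
    and K: "\<And>x. a < x \<Longrightarrow> x \<le> b \<Longrightarrow>
      ennreal ((Q x)\<^sup>2 / F x) * (\<integral>\<^sup>+t. ennreal (1 / Q t * indicator {a..x} t) \<partial>lborel) \<le> K\<^sup>2"
  shows "wasserstein2 (density lborel (\<lambda>t. ennreal (Q t / F y * indicator {a..y} t)))
      (density lborel (\<lambda>t. ennreal (Q t / F z * indicator {a..z} t))) \<le> K * ennreal \<bar>y - z\<bar>"
proof -
  have "(\<integral>\<^sup>+u. ennreal ((quantile y u - quantile z u)\<^sup>2) \<partial>uniform01) \<le> (K * ennreal \<bar>y - z\<bar>)\<^sup>2"
  proof (cases "y \<le> z")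
    case True
    then show ?thesis
      using quantile_displacement[of y z K] K y z by (simp add: power2_commute[of "quantile y _"])
  next
    case False
    then show ?thesis
      using quantile_displacement[of z y K] K y z by simp
  qed
  then show ?thesis
    unfolding distr_quantile[OF y, symmetric] distr_quantile[OF z, symmetric]
    by (intro wasserstein2_le_of_coupled_variables prob_space_uniform01) measurable
qed

section \<open>The constant and the Pareto posterior in terms of the primitive\<close>

lemma energy_eq_C_fun_squared:
  assumes a: "a = 1" and x: "1 < x" "x \<le> b"
    and inv: "set_integrable lborel {1<..<b} (\<lambda>t. 1 / Q t)"
  shows "ennreal ((Q x)\<^sup>2 / F x) * (\<integral>\<^sup>+t. ennreal (1 / Q t * indicator {a..x} t) \<partial>lborel)
    = (ennreal (C_fun Q x))\<^sup>2"
proof -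
  let ?I = "LBINT t:{1<..<x}. 1 / Q t"
  have Fx: "0 < F x" using F_pos[of x] x a by simp
  have inv': "set_integrable lborel {1<..<x} (\<lambda>t. 1 / Q t)"
    by (rule set_integrable_subset[OF inv]) (use x in auto)
  have I0: "0 \<le> ?I"
    unfolding set_lebesgue_integral_def using nonneg by (intro integral_nonneg_AE) auto
  have int: "(\<integral>\<^sup>+t. ennreal (1 / Q t * indicator {a..x} t) \<partial>lborel) = ennreal ?I"
  proof -
    have "(\<integral>\<^sup>+t. ennreal (1 / Q t * indicator {a..x} t) \<partial>lborel)
      = (\<integral>\<^sup>+t. ennreal (indicator {1<..<x} t *\<^sub>R (1 / Q t)) \<partial>lborel)"
      using AE_not_endpoint[of a x]
      by (intro nn_integral_cong_AE, eventually_elim) (auto simp: a indicator_def)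
    also have "\<dots> = ennreal ?I"
      unfolding set_lebesgue_integral_def
      using inv' nonneg by (intro nn_integral_eq_integral) (auto simp: set_integrable_def)
    finally show ?thesis .
  qed
  have "(LBINT t:{1<..<x}. Q t) = (\<integral>t. Q t * indicator {a..x} t \<partial>lborel)"
    unfolding set_lebesgue_integral_def using AE_not_endpoint[of a x]
    by (intro integral_cong_AE, measurable, eventually_elim) (auto simp: a indicator_def)
  then have FQ: "(LBINT t:{1<..<x}. Q t) = F x"
    using integral_Q[of x] a x by simp
  have p1: "(F x powr (-1/2))\<^sup>2 = 1 / F x"
    using Fx by (simp add: powr_minus_divide powr_half_sqrt power_divide)
  have p2: "(?I powr (1/2))\<^sup>2 = ?I"
    using I0 by (simp add: powr_half_sqrt)
  have "(C_fun Q x)\<^sup>2 = (Q x)\<^sup>2 / F x * ?I"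
    unfolding C_fun_def FQ power_mult_distrib p1 p2 by simp
  moreover have "0 \<le> C_fun Q x"
    unfolding C_fun_def using nonneg by simp
  ultimately show ?thesis
    unfolding int using Fx I0 by (simp add: ennreal_power flip: ennreal_mult)
qed

text \<open>Wherever \<open>Q(t) = t q(t)\<close>, likelihood times prior is \<open>Q(t) / x\<^sup>2\<close> below \<open>min x b\<close> and 0 above; the factor \<open>1 / x\<^sup>2\<close> cancels in
  the normalisation.\<close>

lemma posterior_pareto:
  assumes a: "a = 1" and q: "set_integrable lborel {1<..<b} q"
    and qQ: "AE t in lborel. t \<in> {1<..<b} \<longrightarrow> Q t = t * q t" and x: "1 < x"
  shows "posterior {1<..<b} pareto q x
    = density lborel (\<lambda>t. ennreal (Q t / F (min x b) * indicator {a..min x b} t))"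
proof -
  let ?y = "min x b"
  have y: "a < ?y" "?y \<le> b" using x a a_less_b by auto
  define q' where "q' t = indicator {1<..<b} t * q t" for t
  have [measurable]: "q' \<in> borel_measurable borel"
    using borel_measurable_integrable[OF q[unfolded set_integrable_def]] by (simp add: q'_def[abs_def])
  have [measurable]: "pareto x \<in> borel_measurable borel"
    unfolding pareto_def[abs_def] by measurable
  have likelihood: "AE t in lborel. pareto x t * q' t = Q t * indicator {a..?y} t / x\<^sup>2"
    using qQ AE_not_endpoint[of a x] AE_not_endpoint[of a b]
    by eventually_elim (auto simp: a q'_def pareto_def indicator_def)
  have "(LBINT t:{1<..<b}. pareto x t * q t) = (\<integral>t. pareto x t * q' t \<partial>lborel)"
    unfolding set_lebesgue_integral_def q'_def by (intro Bochner_Integration.integral_cong) auto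
  also have "\<dots> = (\<integral>t. Q t * indicator {a..?y} t / x\<^sup>2 \<partial>lborel)"
    using likelihood by (intro integral_cong_AE) measurable
  also have "\<dots> = F ?y / x\<^sup>2"
    using integral_Q[of ?y] y by simp
  finally have normalisation: "(LBINT t:{1<..<b}. pareto x t * q t) = F ?y / x\<^sup>2" .
  have "posterior {1<..<b} pareto q x
      = density lborel (\<lambda>t. ennreal (pareto x t * q' t / (F ?y / x\<^sup>2)))"
    unfolding posterior_def normalisation
    by (intro arg_cong[where f = "density lborel"]) (auto simp: q'_def indicator_def)
  also have "\<dots> = density lborel (\<lambda>t. ennreal (Q t / F ?y * indicator {a..?y} t))"
  proof (rule density_cong)
    show "AE t in lborel. ennreal (pareto x t * q' t / (F ?y / x\<^sup>2)) = ennreal (Q t / F ?y * indicator {a..?y} t)"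
      using likelihood by eventually_elim (use x in simp)
  qed measurable
  finally show ?thesis .
qed

end

section \<open>The Lipschitz estimate\<close>

theorem proposition4p3:
  fixes \<theta>\<^sub>0 :: ereal and \<Theta> :: "real set" and \<pi> :: "real measure"
    and q Q :: "real \<Rightarrow> real"
  assumes "1 < \<theta>\<^sub>0"
    and "\<Theta> = {\<theta>. 1 < \<theta> \<and> ereal \<theta> < \<theta>\<^sub>0}"
    and "prob_space \<pi>"
    and "set_integrable lborel \<Theta> q"
    and "AE \<theta> in lborel. \<theta> \<in> \<Theta> \<longrightarrow> 0 \<le> q \<theta>"
    and "\<pi> = density lborel (\<lambda>\<theta>. indicator \<Theta> \<theta> * ennreal (q \<theta>))"
    and "measure_support \<pi> = closure \<Theta>"
    and "(\<lambda>\<theta>. \<theta> * q \<theta>) \<in> sobolev_W11 \<Theta>"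
    and "continuous_representative \<Theta> (\<lambda>\<theta>. \<theta> * q \<theta>) Q"
    and "AE \<theta> in lborel. \<theta> \<in> \<Theta> \<longrightarrow> Q \<theta> \<noteq> 0"
    and "set_integrable lborel \<Theta> (\<lambda>\<theta>. 1 / Q \<theta>)"
  shows "\<forall>x\<^sub>1\<in>{1<..}. \<forall>x\<^sub>2\<in>{1<..}.
    wasserstein2 (posterior \<Theta> pareto q x\<^sub>1) (posterior \<Theta> pareto q x\<^sub>2)
      \<le> (SUP x\<in>{1<..}. ennreal (C_fun Q (real_of_ereal (min (ereal x) \<theta>\<^sub>0)))) * ennreal \<bar>x\<^sub>1 - x\<^sub>2\<bar>"
proof (intro ballI)
  fix x\<^sub>1 x\<^sub>2 :: real assume "x\<^sub>1 \<in> {1<..}" "x\<^sub>2 \<in> {1<..}"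
  then have x: "1 < x\<^sub>1" "1 < x\<^sub>2" by auto
  let ?K = "SUP x\<in>{1<..}. ennreal (C_fun Q (real_of_ereal (min (ereal x) \<theta>\<^sub>0)))"
  have Q_eq: "AE \<theta> in lborel. \<theta> \<in> \<Theta> \<longrightarrow> Q \<theta> = \<theta> * q \<theta>"
    and Q_cont: "continuous_on (closure \<Theta>) Q"
    using assms(9) by (auto simp: continuous_representative_def)
  have Q_pos: "AE \<theta> in lborel. \<theta> \<in> \<Theta> \<longrightarrow> 0 < Q \<theta>"
    using Q_eq assms(5,10) by eventually_elim (auto simp: assms(2) less_le)
  have \<Theta>_sets: "\<Theta> \<in> sets lborel"
    unfolding assms(2) by measurable
  \<comment> \<open>Otherwise the half-line would have finite length, as both \<open>Q\<close> and \<open>1 / Q\<close> are integrable.\<close>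
  have "\<theta>\<^sub>0 \<noteq> \<infinity>"
  proof
    assume "\<theta>\<^sub>0 = \<infinity>"
    then have \<Theta>: "\<Theta> = {1<..}" by (auto simp: assms(2))
    have "emeasure lborel \<Theta> < \<infinity>"
    proof (rule emeasure_finite_if_integrable_reciprocal[OF \<Theta>_sets _ assms(11)])
      show "set_integrable lborel \<Theta> (\<lambda>\<theta>. \<theta> * q \<theta>)"
        using assms(8) by (simp add: sobolev_W11_def)
      show "AE \<theta> in lborel. \<theta> \<in> \<Theta> \<longrightarrow> 0 < \<theta> * q \<theta> \<and> 1 / Q \<theta> = 1 / (\<theta> * q \<theta>)"
        using Q_pos Q_eq by eventually_elim auto
    qed
    then obtain r where r: "emeasure lborel \<Theta> = ennreal r" "0 \<le> r"
      by (cases "emeasure lborel \<Theta>") auto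
    have "emeasure lborel {1..2 + r} \<le> emeasure lborel (insert 1 \<Theta>)"
      using \<Theta> by (intro emeasure_mono) auto
    also have "\<dots> \<le> emeasure lborel {1::real} + emeasure lborel \<Theta>"
      using emeasure_subadditive[of "{1}" lborel \<Theta>] \<Theta>_sets by simp
    finally show False
      using r by simp
  qed
  with assms(1) obtain b where b: "\<theta>\<^sub>0 = ereal b" "1 < b"
    by (cases \<theta>\<^sub>0) auto
  have \<Theta>: "\<Theta> = {1<..<b}"
    using b by (auto simp: assms(2))
  have closure_\<Theta>: "closure \<Theta> = {1..b}"
    unfolding \<Theta> using b(2) by (rule closure_greaterThanLessThan)

  \<comment> \<open>The hypotheses control \<open>Q\<close> on \<open>[1, b]\<close> only; clamping the argument extends it continuously to the line.\<close>
  define P where "P t = Q (max 1 (min b t))" for t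
  have P_eq: "P t = Q t" if "t \<in> {1..b}" for t
    using that by (simp add: P_def)
  have P_cont: "continuous_on UNIV P"
    unfolding P_def
  proof (rule continuous_on_compose2[where g = Q and t = "{1..b}"])
    show "continuous_on {1..b} Q"
      using Q_cont by (simp only: closure_\<Theta>)
    show "continuous_on UNIV (\<lambda>t. max 1 (min b t))"
      by (intro continuous_intros)
    show "(\<lambda>t. max 1 (min b t)) ` UNIV \<subseteq> {1..b}"
      using b(2) by auto
  qed
  have P_nonneg: "0 \<le> P t" for t
  proof -
    have ae: "AE t in lborel. t \<in> \<Theta> \<longrightarrow> 0 \<le> P t"
      using Q_pos by eventually_elim (auto simp: P_eq \<Theta> less_imp_le)
    have "0 \<le> P (max 1 (min b t))"
      by (rule continuous_nonneg_on_closure[OF P_cont _ ae]) (use b(2) in \<open>simp_all only: closure_\<Theta>, auto simp: \<Theta>\<close>)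
    then show ?thesis
      using b by (simp add: P_def)
  qed
  \<comment> \<open>The interval is enlarged by 1 on both sides to get two-sided derivatives at \<open>1\<close> and \<open>b\<close>.\<close>
  obtain F\<^sub>0 where F\<^sub>0: "\<And>t. t \<in> {0..b + 1} \<Longrightarrow> (F\<^sub>0 has_vector_derivative P t) (at t within {0..b + 1})"
    using antiderivative_continuous[of 0 "b + 1" P] continuous_on_subset[OF P_cont] by blast
  define F where "F t = F\<^sub>0 t - F\<^sub>0 1" for t
  have F_deriv: "(F has_real_derivative P t) (at t)" if "t \<in> {1..b}" for t
  proof -
    have "(F\<^sub>0 has_real_derivative P t) (at t within {0..b + 1})"
      using F\<^sub>0[of t] that by (simp add: has_real_derivative_iff_has_vector_derivative)
    then have "(F\<^sub>0 has_real_derivative P t) (at t)"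
      using that by (simp add: at_within_Icc_at)
    then show ?thesis
      unfolding F_def by (auto intro!: derivative_eq_intros)
  qed
  interpret primitive_of_ae_positive 1 b P F
  proof
    show "AE t in lborel. t \<in> {1..b} \<longrightarrow> P t \<noteq> 0"
      using Q_pos AE_not_endpoint[of 1 b] by eventually_elim (auto simp: P_eq \<Theta>)
  qed (use b P_cont P_nonneg F_deriv F_def in auto)

  have posterior: "posterior \<Theta> pareto q x
      = density lborel (\<lambda>t. ennreal (P t / F (min x b) * indicator {1..min x b} t))" if "1 < x" for x
    unfolding \<Theta>
  proof (rule posterior_pareto)
    show "AE t in lborel. t \<in> {1<..<b} \<longrightarrow> P t = t * q t"
      using Q_eq by eventually_elim (auto simp: P_eq \<Theta>)
  qed (use assms(4) \<Theta> that in auto)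
  have bound: "ennreal ((P x)\<^sup>2 / F x) * (\<integral>\<^sup>+t. ennreal (1 / P t * indicator {1..x} t) \<partial>lborel) \<le> ?K\<^sup>2"
    if x: "1 < x" "x \<le> b" for x
  proof -
    have inv: "set_integrable lborel {1<..<b} (\<lambda>t. 1 / P t)"
      using assms(11) unfolding \<Theta> by (rule set_integrable_cong[THEN iffD1, rotated -1]) (auto simp: P_eq)
    have C: "C_fun P x = C_fun Q (real_of_ereal (min (ereal x) \<theta>\<^sub>0))"
    proof -
      have "(LBINT t:{1<..<x}. P t) = (LBINT t:{1<..<x}. Q t)"
           "(LBINT t:{1<..<x}. 1 / P t) = (LBINT t:{1<..<x}. 1 / Q t)"
        using x by (auto intro!: set_lebesgue_integral_cong simp: P_eq)
      moreover have "real_of_ereal (min (ereal x) \<theta>\<^sub>0) = x"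
        using x b by (simp add: min_def)
      ultimately show ?thesis
        using x by (simp add: C_fun_def P_eq)
    qed
    have "ennreal (C_fun P x) \<le> ?K"
      unfolding C using x by (intro SUP_upper) auto
    then show ?thesis
      unfolding energy_eq_C_fun_squared[OF refl x inv] by (rule power_mono) simp
  qed
  have "wasserstein2 (posterior \<Theta> pareto q x\<^sub>1) (posterior \<Theta> pareto q x\<^sub>2)
      \<le> ?K * ennreal \<bar>min x\<^sub>1 b - min x\<^sub>2 b\<bar>"
    unfolding posterior[OF x(1)] posterior[OF x(2)]
    using x b bound by (intro wasserstein2_truncations_le) auto
  also have "\<dots> \<le> ?K * ennreal \<bar>x\<^sub>1 - x\<^sub>2\<bar>"
    by (intro mult_left_mono ennreal_leI) auto
  finally show "wasserstein2 (posterior \<Theta> pareto q x\<^sub>1) (posterior \<Theta> pareto q x\<^sub>2)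
      \<le> ?K * ennreal \<bar>x\<^sub>1 - x\<^sub>2\<bar>" .
qed

end
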